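(* Suppose that $f:\mathbb{R}_{>0}^n\to\mathbb{R}_{>0}^n$ is a monotone homogeneous map and that it has a positive eigenvector $u$ (i.e., $u\in\mathbb{R}_{>0}^n$ and $f(u)=\lambda u$ for some $\lambda>0$). Then $u$ is the unique positive eigenvector of $f$, up to a scalar factor, if and only if the players do not have disjoint dominions in the game $\Gamma_u(f)$ (there is no pair of disjoint sets, one a dominion of Min and the other a dominion of Max).
   Context: $[n]=\{1,\dots,n\}$; $\mathbb{R}_{>0}^n$ is the set of vectors of $\mathbb{R}^n$ with all entries positive, with the componentwise order. $f$ is monotone homogeneous if $x\le y\Rightarrow f(x)\le f(y)$ and $f(\lambda x)=\lambda f(x)$ for all $\lambda>0$. For $K\subset[n]$, $e_K\in\mathbb{R}^n$ is the vector with entries $1$ on $K$ and $0$ elsewhere, and $K^c=[n]\setminus K$. Local game $\Gamma_u(f)$: let $T=\log\circ f\circ\exp:\mathbb{R}^n\to\mathbb{R}^n$ and $w=\log u\in\mathbb{R}^n$ ($\log,\exp$ acting componentwise). The state space is $[n]$. In state $i$, the actions of player Min are the sets $I\subset[n]$ such that there exists $\varepsilon>0$ with $T_i(w+\alpha e_{I^c})=T_i(w)$ for all $\alpha\in[0,\varepsilon]$; the actions of player Max are the sets $J\subset[n]$ such that there exists $\varepsilon>0$ with $T_i(w-\alpha e_{J^c})=T_i(w)$ for all $\alpha\in[0,\varepsilon]$. At each stage the players choose simultaneously actions $I$ and $J$ and the next state is drawn uniformly in $I\cap J$ (which is never empty). A dominion of a player is a nonempty set $\Delta\subset[n]$ such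 that from any initial state in $\Delta$ that player can force the state to remain almost surely in $\Delta$ at every stage, whatever the other player does; equivalently, a nonempty $\Delta$ such that for every $i\in\Delta$ the set $\Delta$ is itself an action of that player in state $i$. *)

theory Defs
  imports "HOL-Probability.Probability_Mass_Function"
begin

definition pos_cone :: "(real ^ 'n) set" where
  "pos_cone = {x. \<forall>i. 0 < x $ i}"

text \<open>The map \<open>f\<close> is only meaningful on the positive cone; every condition is restricted to it.\<close>

definition monotone_homogeneous :: "(real ^ 'n \<Rightarrow> real ^ 'n) \<Rightarrow> bool" where
  "monotone_homogeneous f \<longleftrightarrow>
     mono_on pos_cone f \<and>
     (\<forall>x\<in>pos_cone. \<forall>c>0. f (c *\<^sub>R x) = c *\<^sub>R f x)"

definition positive_eigenvector :: "(real ^ 'n \<Rightarrow> real ^ 'n) \<Rightarrow> real ^ 'n \<Rightarrow> bool" where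
  "positive_eigenvector f u \<longleftrightarrow> u \<in> pos_cone \<and> (\<exists>l>0. f u = l *\<^sub>R u)"

definition log_vec :: "real ^ 'n \<Rightarrow> real ^ 'n" where
  "log_vec x = (\<chi> i. ln (x $ i))"

definition exp_vec :: "real ^ 'n \<Rightarrow> real ^ 'n" where
  "exp_vec x = (\<chi> i. exp (x $ i))"

definition log_conj :: "(real ^ 'n \<Rightarrow> real ^ 'n) \<Rightarrow> real ^ 'n \<Rightarrow> real ^ 'n" where
  "log_conj f = log_vec \<circ> f \<circ> exp_vec"

definition ind_vec :: "'n set \<Rightarrow> real ^ 'n" where
  "ind_vec K = (\<chi> i. if i \<in> K then 1 else 0)"


subsection \<open>Repeated games whose next state is uniform in the intersection of the actions\<close>

text \<open>
  Actions are sets of states, and a game is given by the set of actions available to each player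
  in each state. A behaviour strategy may randomize, and depends on the current state and on the
  past: the list (most recent stage first) of the previous states together with the actions
  chosen there, first by the player called A, then by the player called B.
\<close>

type_synonym 's history = "('s \<times> 's set \<times> 's set) list"

type_synonym 's strategy = "'s history \<Rightarrow> 's \<Rightarrow> 's set pmf"

definition is_strategy :: "('s \<Rightarrow> 's set set) \<Rightarrow> 's strategy \<Rightarrow> bool" where
  "is_strategy Act \<sigma> \<longleftrightarrow> (\<forall>h s. set_pmf (\<sigma> h s) \<subseteq> Act s)"

text \<open>
  Joint law of the past and the current state after \<open>k\<close> stages. The two actions are drawn
  independently given the past, since the players move simultaneously. Only action sets for which
  \<open>I \<inter> J\<close> is never empty are relevant, as \<open>pmf_of_set {}\<close> is unspecified.
\<close>

primrec play :: "'s strategy \<Rightarrow> 's strategy \<Rightarrow> 's \<Rightarrow> nat \<Rightarrow> ('s history \<times> 's) pmf" where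
  "play \<sigma> \<tau> s\<^sub>0 0 = return_pmf ([], s\<^sub>0)"
| "play \<sigma> \<tau> s\<^sub>0 (Suc k) =
     bind_pmf (play \<sigma> \<tau> s\<^sub>0 k) (\<lambda>(h, s).
     bind_pmf (\<sigma> h s) (\<lambda>I.
     bind_pmf (\<tau> h s) (\<lambda>J.
     map_pmf (\<lambda>s'. ((s, I, J) # h, s')) (pmf_of_set (I \<inter> J)))))"

definition state_at :: "'s strategy \<Rightarrow> 's strategy \<Rightarrow> 's \<Rightarrow> nat \<Rightarrow> 's pmf" where
  "state_at \<sigma> \<tau> s\<^sub>0 k = map_pmf snd (play \<sigma> \<tau> s\<^sub>0 k)"

text \<open>
  Dominions of the player with actions \<open>Act\<close> against an opponent with actions \<open>Opp\<close>. Since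
  \<open>I \<inter> J\<close> is symmetric, either player of a game may be taken as player A of \<^const>\<open>play\<close>.
\<close>

definition is_dominion :: "('s \<Rightarrow> 's set set) \<Rightarrow> ('s \<Rightarrow> 's set set) \<Rightarrow> 's set \<Rightarrow> bool" where
  "is_dominion Act Opp D \<longleftrightarrow>
     D \<noteq> {} \<and>
     (\<forall>s\<in>D. \<exists>\<sigma>. is_strategy Act \<sigma> \<and>
        (\<forall>\<tau>. is_strategy Opp \<tau> \<longrightarrow>
           (\<forall>k. AE t in measure_pmf (state_at \<sigma> \<tau> s k). t \<in> D)))"


subsection \<open>The local game\<close>

definition min_actions :: "(real ^ 'n \<Rightarrow> real ^ 'n) \<Rightarrow> real ^ 'n \<Rightarrow> 'n \<Rightarrow> 'n set set" where
  "min_actions f u i =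
     {I. \<exists>\<epsilon>>0. \<forall>\<alpha>\<in>{0..\<epsilon>}.
        log_conj f (log_vec u + \<alpha> *\<^sub>R ind_vec (- I)) $ i = log_conj f (log_vec u) $ i}"

definition max_actions :: "(real ^ 'n \<Rightarrow> real ^ 'n) \<Rightarrow> real ^ 'n \<Rightarrow> 'n \<Rightarrow> 'n set set" where
  "max_actions f u i =
     {J. \<exists>\<epsilon>>0. \<forall>\<alpha>\<in>{0..\<epsilon>}.
        log_conj f (log_vec u - \<alpha> *\<^sub>R ind_vec (- J)) $ i = log_conj f (log_vec u) $ i}"

definition min_dominion :: "(real ^ 'n \<Rightarrow> real ^ 'n) \<Rightarrow> real ^ 'n \<Rightarrow> 'n set \<Rightarrow> bool" where
  "min_dominion f u = is_dominion (min_actions f u) (max_actions f u)"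

definition max_dominion :: "(real ^ 'n \<Rightarrow> real ^ 'n) \<Rightarrow> real ^ 'n \<Rightarrow> 'n set \<Rightarrow> bool" where
  "max_dominion f u = is_dominion (max_actions f u) (min_actions f u)"

end

theory Submission
  imports Defs
begin

text \<open>
  In logarithmic coordinates centred at \<open>log u\<close>, the map \<open>f\<close> becomes an operator \<open>S\<close> on
  \<open>\<real>\<^sup>n\<close> that is monotone, commutes with the addition of constants, and satisfies \<open>S 0 = 0\<close>.
  A positive eigenvector of \<open>f\<close> corresponds to a vector \<open>x\<close> with \<open>S x = x + c\<close>; comparing \<open>x\<close> with its
  maximum and its minimum gives \<open>c = 0\<close>. Hence \<open>u\<close> is the unique eigenvector up to scaling exactly
  when every fixed point of \<open>S\<close> is constant.

  On the side of the game, a set \<open>D\<close> is a dominion of a player exactly when \<open>D\<close> itself is an action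
  of that player in each state of \<open>D\<close> (\<open>is_dominion_iff\<close>): the opponent may play the full set, so
  an action that keeps the state in \<open>D\<close> is contained in \<open>D\<close>, and actions are closed under supersets.

  The two sides are linked as follows. If \<open>x\<close> is a nonconstant fixed point, then the set where \<open>x\<close> is
  minimal is a dominion of Min and the set where it is maximal is a dominion of Max, since \<open>x\<close>
  itself bounds the perturbations that define the actions (\<open>argmin_in_actions\<close>). Conversely,
  let \<open>D\<close> and \<open>E\<close> be disjoint dominions of Min and Max. For small \<open>\<alpha> > 0\<close> the vector
  \<open>\<alpha> e\<^sub>E\<close> is a subfixed point, \<open>\<alpha> e\<^bsub>-D\<^esub>\<close> is a superfixed point, and the first lies below the
  second. Knaster--Tarski yields a fixed point between them; it is \<open>0\<close> on \<open>D\<close> and \<open>\<alpha>\<close> on \<open>E\<close>.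
\<close>

section \<open>Dominions as sets that are actions in each of their states\<close>

text \<open>Keeping the action \<open>D\<close> forever traps the state: the next state lies in \<open>D \<inter> J\<close>, and this set
  being nonempty prevents the uniform law on it from being unspecified.\<close>

lemma play_stays:
  fixes D :: "'s::finite set"
  assumes \<sigma>: "\<And>h s. s \<in> D \<Longrightarrow> \<sigma> h s = return_pmf D"
    and \<tau>: "is_strategy Opp \<tau>"
    and meet: "\<And>s J. s \<in> D \<Longrightarrow> J \<in> Opp s \<Longrightarrow> D \<inter> J \<noteq> {}"
    and "s\<^sub>0 \<in> D"
  shows "snd ` set_pmf (play \<sigma> \<tau> s\<^sub>0 k) \<subseteq> D"
proof (induction k)
  case 0
  then show ?case using \<open>s\<^sub>0 \<in> D\<close> by simp
next
  case (Suc k)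
  have "s' \<in> D"
    if hs: "(h, s) \<in> set_pmf (play \<sigma> \<tau> s\<^sub>0 k)" and I: "I \<in> set_pmf (\<sigma> h s)"
      and J: "J \<in> set_pmf (\<tau> h s)" and s': "s' \<in> set_pmf (pmf_of_set (I \<inter> J))"
    for h s I J s'
  proof -
    have "s \<in> D" using Suc hs by force
    moreover from this have "I = D" using I \<sigma> by simp
    moreover have "J \<in> Opp s" using J \<tau> by (auto simp: is_strategy_def)
    ultimately show ?thesis using s' meet[of s J] by (simp add: set_pmf_of_set)
  qed
  then show ?case by fastforce
qed

lemma is_dominion_iff:
  fixes D :: "'s::finite set"
  assumes Act_UNIV: "\<And>s. UNIV \<in> Act s" and Opp_UNIV: "\<And>s. UNIV \<in> Opp s"
    and up: "\<And>s I I'. I \<in> Act s \<Longrightarrow> I \<subseteq> I' \<Longrightarrow> I' \<in> Act s"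
    and meet: "\<And>s I J. I \<in> Act s \<Longrightarrow> J \<in> Opp s \<Longrightarrow> I \<inter> J \<noteq> {}"
  shows "is_dominion Act Opp D \<longleftrightarrow> D \<noteq> {} \<and> (\<forall>s\<in>D. D \<in> Act s)"
proof (intro iffI conjI ballI)
  assume "is_dominion Act Opp D"
  then show "D \<noteq> {}" by (simp add: is_dominion_def)
next
  fix s assume dom: "is_dominion Act Opp D" and "s \<in> D"
  then obtain \<sigma> where \<sigma>: "is_strategy Act \<sigma>"
    and stay: "\<And>\<tau> k. is_strategy Opp \<tau> \<Longrightarrow> set_pmf (state_at \<sigma> \<tau> s k) \<subseteq> D"
    unfolding is_dominion_def AE_measure_pmf_iff by blast
  obtain I where I: "I \<in> set_pmf (\<sigma> [] s)"
    using set_pmf_not_empty by fast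
  then have act: "I \<in> Act s" using \<sigma> by (auto simp: is_strategy_def)
  then have "I \<noteq> {}" using meet[of I s UNIV] Opp_UNIV by simp
  (* One stage suffices: against the full set, every state of I is reached with positive probability. *)
  have "is_strategy Opp (\<lambda>h s. return_pmf UNIV)" using Opp_UNIV by (simp add: is_strategy_def)
  from stay[OF this, of "Suc 0"]
  have "(\<Union>I \<in> set_pmf (\<sigma> [] s). set_pmf (pmf_of_set I)) \<subseteq> D"
    by (simp add: state_at_def map_bind_pmf bind_return_pmf map_pmf_comp)
  then have "set_pmf (pmf_of_set I) \<subseteq> D" using I by blast
  then have "I \<subseteq> D" using \<open>I \<noteq> {}\<close> by (simp add: set_pmf_of_set)
  then show "D \<in> Act s" using up act by blast
next
  assume D: "D \<noteq> {} \<and> (\<forall>s\<in>D. D \<in> Act s)"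
  define \<sigma> where "\<sigma> h s = return_pmf (if s \<in> D then D else UNIV)" for h :: "'s history" and s
  have "is_strategy Act \<sigma>" using D Act_UNIV by (simp add: is_strategy_def \<sigma>_def)
  moreover have "snd ` set_pmf (play \<sigma> \<tau> s k) \<subseteq> D"
    if "s \<in> D" "is_strategy Opp \<tau>" for s \<tau> k
    using that D meet by (intro play_stays) (auto simp: \<sigma>_def)
  ultimately show "is_dominion Act Opp D"
    using D unfolding is_dominion_def AE_measure_pmf_iff state_at_def by auto blast
qed


section \<open>Monotone operators that commute with the addition of constants\<close>

text \<open>Knaster--Tarski on an order interval of \<open>\<real>\<^sup>n\<close>: the componentwise supremum of the subfixed points
  in the interval is a fixed point.\<close>

lemma fixed_point_between:
  fixes S :: "real ^ 'n \<Rightarrow> real ^ 'n"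
  assumes mono: "\<And>x y. x \<le> y \<Longrightarrow> S x \<le> S y"
    and a: "a \<le> S a" and b: "S b \<le> b" and ab: "a \<le> b"
  obtains z where "a \<le> z" "z \<le> b" "S z = z"
proof -
  define A where "A = {x. a \<le> x \<and> x \<le> b \<and> x \<le> S x}"
  define z :: "real ^ 'n" where "z = (\<chi> i. SUP x\<in>A. x $ i)"
  have "a \<in> A" using a ab by (simp add: A_def)
  have upper: "x \<le> z" if "x \<in> A" for x
  proof -
    have "bdd_above ((\<lambda>x. x $ i) ` A)" for i
      by (rule bdd_aboveI2[of _ _ "b $ i"]) (simp add: A_def less_eq_vec_def)
    then show ?thesis using that by (auto simp: z_def less_eq_vec_def intro!: cSUP_upper)
  qed
  have least: "z \<le> y" if "\<And>x. x \<in> A \<Longrightarrow> x \<le> y" for y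
    using that \<open>a \<in> A\<close> unfolding less_eq_vec_def z_def by (auto intro!: cSUP_least)
  have az: "a \<le> z" using upper \<open>a \<in> A\<close> .
  have zb: "z \<le> b" by (rule least) (simp add: A_def)
  have z_le: "z \<le> S z"
  proof (rule least)
    fix x assume "x \<in> A"
    then have "x \<le> S x" "S x \<le> S z" using upper mono by (auto simp: A_def)
    then show "x \<le> S z" by (rule order_trans)
  qed
  have "S z \<in> A"
    using order_trans[OF az z_le] order_trans[OF mono[OF zb] b] mono[OF z_le] by (simp add: A_def)
  then have "S z = z" using upper z_le by (simp add: antisym)
  with az zb show thesis by (rule that)
qed

locale normalized_operator =
  fixes S :: "real ^ 'n \<Rightarrow> real ^ 'n"
  assumes mono: "x \<le> y \<Longrightarrow> S x \<le> S y"
    and add_const: "S (x + vec c) = S x + vec c"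
    and zero: "S 0 = 0"

text \<open>The actions of Min at the fixed point \<open>0\<close>; those of Max are the same sets for the
  dual operator \<open>x \<mapsto> - S (- x)\<close>, so that each fact about Min also serves for Max.\<close>

definition actions :: "(real ^ 'n \<Rightarrow> real ^ 'n) \<Rightarrow> 'n \<Rightarrow> 'n set set" where
  "actions S i = {I. \<exists>\<epsilon>>0. \<forall>\<alpha>\<in>{0..\<epsilon>}. S (\<alpha> *\<^sub>R ind_vec (- I)) $ i = 0}"

abbreviation dual :: "(real ^ 'n \<Rightarrow> real ^ 'n) \<Rightarrow> real ^ 'n \<Rightarrow> real ^ 'n" where
  "dual S \<equiv> \<lambda>x. - S (- x)"

context normalized_operator
begin

lemma normalized_operator_dual: "normalized_operator (dual S)"
proof
  show "dual S x \<le> dual S y" if "x \<le> y" for x y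
    using mono[of "- y" "- x"] that by (simp add: less_eq_vec_def)
  show "dual S (x + vec c) = dual S x + vec c" for x c
  proof -
    have "- (x + vec c) = - x + vec (- c)" by (simp add: vec_eq_iff)
    then show ?thesis by (simp only: add_const) (simp add: vec_eq_iff)
  qed
  show "dual S 0 = 0" by (simp add: zero)
qed

lemma const: "S (vec c) = vec c"
  using add_const[of 0 c] by (simp add: zero)

lemma nonneg: "0 \<le> x \<Longrightarrow> 0 \<le> S x $ i"
  using mono[of 0 x] by (simp add: zero less_eq_vec_def)

text \<open>Since \<open>S x \<ge> 0\<close> for \<open>x \<ge> 0\<close>, it suffices to bound \<open>S\<close> from above for a single
  perturbation: smaller perturbations are then covered by monotonicity.\<close>

lemma actionsI:
  assumes "\<epsilon> > 0" "S (\<epsilon> *\<^sub>R ind_vec (- I)) $ i \<le> 0"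
  shows "I \<in> actions S i"
proof -
  have "S (\<alpha> *\<^sub>R ind_vec (- I)) $ i = 0" if "\<alpha> \<in> {0..\<epsilon>}" for \<alpha>
  proof (rule antisym)
    have "\<alpha> *\<^sub>R ind_vec (- I) \<le> (\<epsilon> *\<^sub>R ind_vec (- I) :: real ^ 'n)"
      using that by (simp add: less_eq_vec_def ind_vec_def)
    then show "S (\<alpha> *\<^sub>R ind_vec (- I)) $ i \<le> 0"
      using mono assms(2) unfolding less_eq_vec_def by (meson order_trans)
    show "0 \<le> S (\<alpha> *\<^sub>R ind_vec (- I)) $ i"
      using that by (intro nonneg) (simp add: less_eq_vec_def ind_vec_def)
  qed
  with assms(1) show ?thesis by (auto simp: actions_def)
qed

lemma UNIV_in_actions: "UNIV \<in> actions S i"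
proof -
  have "ind_vec (- UNIV) = (0 :: real ^ 'n)" by (simp add: ind_vec_def vec_eq_iff)
  then show ?thesis by (intro actionsI[of 1]) (simp_all add: zero)
qed

lemma actions_superset:
  assumes "I \<in> actions S i" "I \<subseteq> I'"
  shows "I' \<in> actions S i"
proof -
  obtain \<epsilon> where \<epsilon>: "\<epsilon> > 0" "S (\<epsilon> *\<^sub>R ind_vec (- I)) $ i = 0"
    using assms(1) by (force simp: actions_def)
  have "\<epsilon> *\<^sub>R ind_vec (- I') \<le> (\<epsilon> *\<^sub>R ind_vec (- I) :: real ^ 'n)"
    using \<epsilon>(1) assms(2) by (auto simp: less_eq_vec_def ind_vec_def)
  then have "S (\<epsilon> *\<^sub>R ind_vec (- I')) $ i \<le> 0"
    using mono \<epsilon>(2) unfolding less_eq_vec_def by metis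
  with \<epsilon>(1) show ?thesis by (rule actionsI)
qed

text \<open>Turning an action of Max into a lower bound for positive perturbations uses the shift
  \<open>\<alpha> - \<alpha> e\<^bsub>-J\<^esub> = \<alpha> e\<^sub>J\<close>.\<close>

lemma dual_actions_shift:
  assumes "J \<in> actions (dual S) i"
  obtains \<epsilon> where "\<epsilon> > 0" "\<And>\<alpha>. \<alpha> \<in> {0..\<epsilon>} \<Longrightarrow> S (\<alpha> *\<^sub>R ind_vec J) $ i = \<alpha>"
proof -
  obtain \<epsilon> where \<epsilon>: "\<epsilon> > 0" "\<And>\<alpha>. \<alpha> \<in> {0..\<epsilon>} \<Longrightarrow> S (- (\<alpha> *\<^sub>R ind_vec (- J))) $ i = 0"
    using assms by (auto simp: actions_def)
  have "S (\<alpha> *\<^sub>R ind_vec J) $ i = \<alpha>" if "\<alpha> \<in> {0..\<epsilon>}" for \<alpha>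
  proof -
    have "\<alpha> *\<^sub>R ind_vec J = - (\<alpha> *\<^sub>R ind_vec (- J)) + (vec \<alpha> :: real ^ 'n)"
      by (simp add: vec_eq_iff ind_vec_def)
    then show ?thesis using \<epsilon>(2)[OF that] by (simp only: add_const) simp
  qed
  with \<epsilon>(1) show thesis by (rule that)
qed

text \<open>Uniform sampling from the intersection of the two actions makes sense. If
  \<open>I\<close> and \<open>J\<close> were disjoint, then \<open>e\<^sub>J \<le> e\<^bsub>-I\<^esub>\<close>, so that a perturbation that leaves
  \<open>S\<^sub>i\<close> at \<open>0\<close> would dominate one that raises it to \<open>\<alpha> > 0\<close>.\<close>

lemma actions_meet:
  assumes "I \<in> actions S i" "J \<in> actions (dual S) i"
  shows "I \<inter> J \<noteq> {}"
proof
  assume disj: "I \<inter> J = {}"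
  obtain \<epsilon> where \<epsilon>: "\<epsilon> > 0" "\<And>\<alpha>. \<alpha> \<in> {0..\<epsilon>} \<Longrightarrow> S (\<alpha> *\<^sub>R ind_vec (- I)) $ i = 0"
    using assms(1) by (auto simp: actions_def)
  obtain \<delta> where \<delta>: "\<delta> > 0" "\<And>\<alpha>. \<alpha> \<in> {0..\<delta>} \<Longrightarrow> S (\<alpha> *\<^sub>R ind_vec J) $ i = \<alpha>"
    using dual_actions_shift[OF assms(2)] by blast
  define \<alpha> where "\<alpha> = min \<epsilon> \<delta>"
  have \<alpha>: "\<alpha> > 0" "\<alpha> \<in> {0..\<epsilon>}" "\<alpha> \<in> {0..\<delta>}" using \<epsilon>(1) \<delta>(1) by (auto simp: \<alpha>_def)
  have "\<alpha> *\<^sub>R ind_vec J \<le> (\<alpha> *\<^sub>R ind_vec (- I) :: real ^ 'n)"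
    using disj \<alpha>(1) by (auto simp: less_eq_vec_def ind_vec_def)
  from mono[OF this] have "\<alpha> \<le> 0"
    using \<epsilon>(2)[OF \<alpha>(2)] \<delta>(2)[OF \<alpha>(3)] unfolding less_eq_vec_def by metis
  with \<alpha>(1) show False by simp
qed

text \<open>At an index where \<open>x\<close> is minimal, \<open>x\<close> dominates the constant vector with that value, which
  \<open>S\<close> fixes; hence \<open>S x\<close> cannot fall below \<open>x\<close> there.\<close>

lemma eigenvalue_nonneg:
  assumes "S x = x + vec c"
  shows "0 \<le> c"
proof -
  obtain i where i: "\<And>j. x $ i \<le> x $ j"
    using ex_is_arg_min_if_finite[of UNIV "($) x"] by (auto simp: is_arg_min_linorder)
  have "vec (x $ i) \<le> x" using i by (simp add: less_eq_vec_def)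
  from mono[OF this] have "x $ i \<le> S x $ i" by (simp add: const less_eq_vec_def)
  with assms show ?thesis by simp
qed

lemma eigenvalue_zero:
  assumes "S x = x + vec c"
  shows "c = 0"
proof -
  interpret d: normalized_operator "dual S" by (rule normalized_operator_dual)
  have "dual S (- x) = - x + vec (- c)" using assms by (simp add: vec_eq_iff)
  then have "0 \<le> - c" by (rule d.eigenvalue_nonneg)
  with eigenvalue_nonneg[OF assms] show ?thesis by simp
qed

text \<open>A fixed point \<open>x\<close> with minimum \<open>m\<close> on \<open>D\<close> dominates \<open>m + \<epsilon> e\<^bsub>-D\<^esub>\<close> once \<open>\<epsilon>\<close> is at most the gap
  between \<open>m\<close> and the other values of \<open>x\<close>; on \<open>D\<close>, therefore, \<open>S\<close> does not react to \<open>\<epsilon> e\<^bsub>-D\<^esub>\<close>.\<close>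

lemma argmin_in_actions:
  assumes fixpt: "S x = x" and i: "\<And>j. x $ i \<le> x $ j"
  shows "{k. x $ k = x $ i} \<in> actions S i"
proof -
  define D where "D = {k. x $ k = x $ i}"
  define \<epsilon> where "\<epsilon> = Min (insert 1 ((\<lambda>j. x $ j - x $ i) ` (- D)))"
  have "x $ i < x $ j" if "j \<notin> D" for j
    using i[of j] that by (simp add: D_def)
  then have "\<epsilon> > 0" by (simp add: \<epsilon>_def)
  have gap: "\<epsilon> \<le> x $ j - x $ i" if "j \<notin> D" for j
    unfolding \<epsilon>_def using that by (intro Min_le) auto
  have "\<epsilon> *\<^sub>R ind_vec (- D) + vec (x $ i) \<le> x"
    using gap i by (fastforce simp: less_eq_vec_def ind_vec_def)
  from mono[OF this] have "S (\<epsilon> *\<^sub>R ind_vec (- D)) $ i + x $ i \<le> x $ i"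
    unfolding add_const fixpt less_eq_vec_def by (auto dest: spec[of _ i])
  then have "S (\<epsilon> *\<^sub>R ind_vec (- D)) $ i \<le> 0" by simp
  with \<open>\<epsilon> > 0\<close> show ?thesis unfolding D_def by (rule actionsI)
qed

lemma disjoint_closed_sets_if_nonconstant_fixed_point:
  assumes fixpt: "S x = x" and nonconst: "x $ k \<noteq> x $ l"
  obtains D E where "D \<noteq> {}" "\<forall>i\<in>D. D \<in> actions S i"
    "E \<noteq> {}" "\<forall>i\<in>E. E \<in> actions (dual S) i" "D \<inter> E = {}"
proof -
  interpret d: normalized_operator "dual S" by (rule normalized_operator_dual)
  obtain i where i: "\<And>j. x $ i \<le> x $ j"
    using ex_is_arg_min_if_finite[of UNIV "($) x"] by (auto simp: is_arg_min_linorder)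
  obtain m where m: "\<And>j. x $ j \<le> x $ m"
    using ex_is_arg_min_if_finite[of UNIV "\<lambda>j. - x $ j"] by (auto simp: is_arg_min_linorder)
  let ?D = "{j. x $ j = x $ i}" and ?E = "{j. x $ j = x $ m}"
  have "\<forall>j\<in>?D. ?D \<in> actions S j"
    proof
    fix j assume "j \<in> ?D"
    then show "?D \<in> actions S j" using argmin_in_actions[OF fixpt, of j] i by simp
  qed
  moreover have "\<forall>j\<in>?E. ?E \<in> actions (dual S) j"
    proof
    fix j assume "j \<in> ?E"
    then show "?E \<in> actions (dual S) j" using d.argmin_in_actions[of "- x" j] fixpt m by simp
  qed
  moreover have "x $ i \<noteq> x $ m" using i[of k] i[of l] m[of k] m[of l] nonconst by simp
  then have "?D \<inter> ?E = {}" by auto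
  ultimately show thesis by (intro that) auto
qed

text \<open>Finiteness of \<open>D\<close> gives a perturbation size that works at all its states simultaneously, so
  that \<open>S (\<alpha> e\<^bsub>-D\<^esub>)\<close> vanishes on \<open>D\<close>; outside \<open>D\<close> it is bounded by \<open>S \<alpha> = \<alpha>\<close>.\<close>

lemma superfixed_point:
  assumes "\<forall>i\<in>D. D \<in> actions S i"
  obtains \<epsilon> where "\<epsilon> > 0" "\<And>\<alpha>. \<alpha> \<in> {0..\<epsilon>} \<Longrightarrow> S (\<alpha> *\<^sub>R ind_vec (- D)) \<le> \<alpha> *\<^sub>R ind_vec (- D)"
proof -
  obtain e where e: "\<And>i. i \<in> D \<Longrightarrow> e i > 0"
    "\<And>i \<alpha>. i \<in> D \<Longrightarrow> \<alpha> \<in> {0..e i} \<Longrightarrow> S (\<alpha> *\<^sub>R ind_vec (- D)) $ i = 0"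
    proof -
    have "\<forall>i\<in>D. \<exists>\<epsilon>>0. \<forall>\<alpha>\<in>{0..\<epsilon>}. S (\<alpha> *\<^sub>R ind_vec (- D)) $ i = 0"
      using assms by (simp add: actions_def)
    from bchoice[OF this] show ?thesis using that by blast
  qed
  define \<epsilon> where "\<epsilon> = Min (insert 1 (e ` D))"
  have "\<epsilon> > 0" using e(1) by (auto simp: \<epsilon>_def)
  moreover have "S (\<alpha> *\<^sub>R ind_vec (- D)) \<le> \<alpha> *\<^sub>R ind_vec (- D)" if \<alpha>: "\<alpha> \<in> {0..\<epsilon>}" for \<alpha>
    unfolding less_eq_vec_def
  proof
    fix i
    show "S (\<alpha> *\<^sub>R ind_vec (- D)) $ i \<le> (\<alpha> *\<^sub>R ind_vec (- D)) $ i"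
    proof (cases "i \<in> D")
      case True
      then have "\<epsilon> \<le> e i" unfolding \<epsilon>_def by (intro Min_le) auto
      then show ?thesis using e(2)[OF True, of \<alpha>] \<alpha> True by (simp add: ind_vec_def)
    next
      case False
      have "\<alpha> *\<^sub>R ind_vec (- D) \<le> (vec \<alpha> :: real ^ 'n)"
        using \<alpha> by (simp add: less_eq_vec_def ind_vec_def)
      from mono[OF this] show ?thesis using False by (simp add: const less_eq_vec_def ind_vec_def)
    qed
  qed
  ultimately show thesis by (rule that)
qed

lemma nonconstant_fixed_point_if_disjoint_closed_sets:
  assumes D: "D \<noteq> {}" "\<forall>i\<in>D. D \<in> actions S i"
    and E: "E \<noteq> {}" "\<forall>i\<in>E. E \<in> actions (dual S) i" and disj: "D \<inter> E = {}"
  obtains z k l where "S z = z" "z $ k \<noteq> z $ l"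
proof -
  interpret d: normalized_operator "dual S" by (rule normalized_operator_dual)
  obtain \<epsilon> where \<epsilon>: "\<epsilon> > 0" "\<And>\<alpha>. \<alpha> \<in> {0..\<epsilon>} \<Longrightarrow> S (\<alpha> *\<^sub>R ind_vec (- D)) \<le> \<alpha> *\<^sub>R ind_vec (- D)"
    using superfixed_point[OF D(2)] by blast
  obtain \<delta> where \<delta>: "\<delta> > 0"
    "\<And>\<alpha>. \<alpha> \<in> {0..\<delta>} \<Longrightarrow> dual S (\<alpha> *\<^sub>R ind_vec (- E)) \<le> \<alpha> *\<^sub>R ind_vec (- E)"
    using d.superfixed_point[OF E(2)] by blast
  define \<alpha> where "\<alpha> = min \<epsilon> \<delta>"
  have \<alpha>: "\<alpha> > 0" "\<alpha> \<in> {0..\<epsilon>}" "\<alpha> \<in> {0..\<delta>}" using \<epsilon>(1) \<delta>(1) by (auto simp: \<alpha>_def)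
  let ?a = "\<alpha> *\<^sub>R ind_vec E :: real ^ 'n" and ?b = "\<alpha> *\<^sub>R ind_vec (- D) :: real ^ 'n"
  have shift: "?a = - (\<alpha> *\<^sub>R ind_vec (- E)) + vec \<alpha>"
    by (simp add: vec_eq_iff ind_vec_def)
  have "- (\<alpha> *\<^sub>R ind_vec (- E)) \<le> S (- (\<alpha> *\<^sub>R ind_vec (- E)))"
    using \<delta>(2)[OF \<alpha>(3)] by (simp add: less_eq_vec_def minus_le_iff)
  then have "?a \<le> S ?a"
    unfolding shift add_const by (simp add: less_eq_vec_def)
  moreover have "?a \<le> ?b" using disj \<alpha>(1) by (auto simp: less_eq_vec_def ind_vec_def)
  ultimately obtain z where z: "?a \<le> z" "z \<le> ?b" "S z = z"
    using fixed_point_between[of S ?a ?b] mono \<epsilon>(2)[OF \<alpha>(2)] by blast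
  obtain k l where kl: "k \<in> D" "l \<in> E" using D(1) E(1) by blast
  have "z $ k \<le> 0"
    using z(2) kl(1) unfolding less_eq_vec_def by (auto simp: ind_vec_def dest: spec[of _ k])
  moreover have "\<alpha> \<le> z $ l"
    using z(1) kl(2) unfolding less_eq_vec_def by (auto simp: ind_vec_def dest: spec[of _ l])
  ultimately have "z $ k \<noteq> z $ l" using \<alpha>(1) by simp
  with z(3) show thesis by (rule that)
qed

end


section \<open>From positive eigenvectors to fixed points\<close>

lemma exp_vec_log_vec: "x \<in> pos_cone \<Longrightarrow> exp_vec (log_vec x) = x"
  by (simp add: pos_cone_def exp_vec_def log_vec_def vec_eq_iff)

lemma log_vec_exp_vec: "log_vec (exp_vec x) = x"
  by (simp add: exp_vec_def log_vec_def vec_eq_iff)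

lemma exp_vec_pos: "exp_vec x \<in> pos_cone"
  by (simp add: pos_cone_def exp_vec_def)

lemma exp_vec_add_const: "exp_vec (x + vec c) = exp c *\<^sub>R exp_vec x"
  by (simp add: exp_vec_def vec_eq_iff exp_add)

lemma log_vec_scale: "x \<in> pos_cone \<Longrightarrow> c > 0 \<Longrightarrow> log_vec (c *\<^sub>R x) = log_vec x + vec (ln c)"
  by (simp add: log_vec_def pos_cone_def vec_eq_iff ln_mult_pos)

lemma positive_eigenvector_exp_vec_iff:
  fixes f :: "real ^ 'n \<Rightarrow> real ^ 'n"
  assumes "f \<in> pos_cone \<rightarrow> pos_cone"
  shows "positive_eigenvector f (exp_vec x) \<longleftrightarrow> (\<exists>c. log_conj f x = x + vec c)"
proof
  assume "positive_eigenvector f (exp_vec x)"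
  then obtain l where "l > 0" "f (exp_vec x) = l *\<^sub>R exp_vec x"
    by (auto simp: positive_eigenvector_def)
  then have "log_conj f x = x + vec (ln l)"
    by (simp add: log_conj_def log_vec_scale exp_vec_pos log_vec_exp_vec)
  then show "\<exists>c. log_conj f x = x + vec c" ..
next
  assume "\<exists>c. log_conj f x = x + vec c"
  then obtain c where "log_vec (f (exp_vec x)) = x + vec c" by (auto simp: log_conj_def)
  then have "exp_vec (log_vec (f (exp_vec x))) = exp c *\<^sub>R exp_vec x"
    by (simp add: exp_vec_add_const)
  moreover have "f (exp_vec x) \<in> pos_cone" using assms exp_vec_pos by blast
  ultimately have "f (exp_vec x) = exp c *\<^sub>R exp_vec x" by (simp add: exp_vec_log_vec)
  then show "positive_eigenvector f (exp_vec x)"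
    unfolding positive_eigenvector_def using exp_vec_pos exp_gt_zero by blast
qed

definition centred_log_conj :: "(real ^ 'n \<Rightarrow> real ^ 'n) \<Rightarrow> real ^ 'n \<Rightarrow> real ^ 'n \<Rightarrow> real ^ 'n" where
  "centred_log_conj f u x = log_conj f (log_vec u + x) - log_conj f (log_vec u)"

lemma normalized_operator_centred_log_conj:
  fixes f :: "real ^ 'n \<Rightarrow> real ^ 'n"
  assumes pos: "f \<in> pos_cone \<rightarrow> pos_cone" and mh: "monotone_homogeneous f"
  shows "normalized_operator (centred_log_conj f u)"
proof
  have fpos: "f (exp_vec x) \<in> pos_cone" for x using pos exp_vec_pos by blast
  have mono: "log_conj f x \<le> log_conj f y" if "x \<le> y" for x y
  proof -
    have "exp_vec x \<le> exp_vec y" using that by (simp add: less_eq_vec_def exp_vec_def)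
    then have "f (exp_vec x) \<le> f (exp_vec y)"
      using mh exp_vec_pos by (auto simp: monotone_homogeneous_def intro: mono_onD)
    then show ?thesis
      using fpos[of x] fpos[of y]
      by (simp add: log_conj_def log_vec_def less_eq_vec_def pos_cone_def)
  qed
  show "centred_log_conj f u x \<le> centred_log_conj f u y" if "x \<le> y" for x y
    using mono[of "log_vec u + x" "log_vec u + y"] that
    by (simp add: centred_log_conj_def less_eq_vec_def)
  have "log_conj f (x + vec c) = log_conj f x + vec c" for x c
  proof -
    have "f (exp c *\<^sub>R exp_vec x) = exp c *\<^sub>R f (exp_vec x)"
      using mh exp_vec_pos exp_gt_zero unfolding monotone_homogeneous_def by blast
    then show ?thesis
      by (simp add: log_conj_def exp_vec_add_const log_vec_scale[OF fpos])
  qed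
  from this[of "log_vec u + x" for x]
  show "centred_log_conj f u (x + vec c) = centred_log_conj f u x + vec c" for x c
    by (simp add: centred_log_conj_def add.assoc)
  show "centred_log_conj f u 0 = 0" by (simp add: centred_log_conj_def)
qed

lemma min_actions_eq: "min_actions f u i = actions (centred_log_conj f u) i"
  by (simp add: min_actions_def actions_def centred_log_conj_def)

lemma max_actions_eq: "max_actions f u i = actions (dual (centred_log_conj f u)) i"
  by (simp add: max_actions_def actions_def centred_log_conj_def
      eq_commute[of "log_conj f (log_vec u) $ i"])

text \<open>Subtracting the eigenvalue equation of \<open>u\<close> shows that \<open>exp_vec (log_vec u + x)\<close> is an
  eigenvector iff \<open>S x - x\<close> is constant, and the constant can only be \<open>0\<close>.\<close>

lemma positive_eigenvector_iff_fixed_point: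
  fixes f :: "real ^ 'n \<Rightarrow> real ^ 'n"
  assumes pos: "f \<in> pos_cone \<rightarrow> pos_cone" and mh: "monotone_homogeneous f"
    and u: "positive_eigenvector f u"
  shows "positive_eigenvector f (exp_vec (log_vec u + x)) \<longleftrightarrow> centred_log_conj f u x = x"
proof -
  interpret normalized_operator "centred_log_conj f u"
    using pos mh by (rule normalized_operator_centred_log_conj)
  have "u = exp_vec (log_vec u)" using u by (simp add: positive_eigenvector_def exp_vec_log_vec)
  then obtain m where m: "log_conj f (log_vec u) = log_vec u + vec m"
    using u positive_eigenvector_exp_vec_iff[OF pos] by metis
  have "log_conj f (log_vec u + x) = log_vec u + x + vec c
      \<longleftrightarrow> centred_log_conj f u x = x + vec (c - m)" for c
    by (auto simp: centred_log_conj_def m vec_eq_iff algebra_simps)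
  then have "positive_eigenvector f (exp_vec (log_vec u + x))
      \<longleftrightarrow> (\<exists>c. centred_log_conj f u x = x + vec (c - m))"
    by (simp add: positive_eigenvector_exp_vec_iff[OF pos])
  also have "\<dots> \<longleftrightarrow> centred_log_conj f u x = x"
  proof
    assume "\<exists>c. centred_log_conj f u x = x + vec (c - m)"
    then obtain c where c: "centred_log_conj f u x = x + vec (c - m)" ..
    from eigenvalue_zero[OF c] c show "centred_log_conj f u x = x" by (simp add: vec_eq_iff)
  next
    assume "centred_log_conj f u x = x"
    then have "centred_log_conj f u x = x + vec (m - m)" by (simp add: vec_eq_iff)
    then show "\<exists>c. centred_log_conj f u x = x + vec (c - m)" ..
  qed
  finally show ?thesis .
qed

lemma exp_vec_log_vec_add_proportional_iff:
  fixes u :: "real ^ 'n"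
  assumes "u \<in> pos_cone"
  shows "(\<exists>c>0. exp_vec (log_vec u + x) = c *\<^sub>R u) \<longleftrightarrow> (\<forall>k l. x $ k = x $ l)"
proof
  assume "\<exists>c>0. exp_vec (log_vec u + x) = c *\<^sub>R u"
  then obtain c where "c > 0" "exp_vec (log_vec u + x) = c *\<^sub>R u" by blast
  then have "log_vec u + x = log_vec u + vec (ln c)"
    using assms by (metis log_vec_exp_vec log_vec_scale)
  then have "x = vec (ln c)" by simp
  then show "\<forall>k l. x $ k = x $ l" by simp
next
  assume const: "\<forall>k l. x $ k = x $ l"
  have "x = vec (x $ undefined)" using const by (simp add: vec_eq_iff)
  then have "exp_vec (log_vec u + x) = exp (x $ undefined) *\<^sub>R u"
    using exp_vec_add_const exp_vec_log_vec[OF assms] by metis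
  then show "\<exists>c>0. exp_vec (log_vec u + x) = c *\<^sub>R u" using exp_gt_zero by blast
qed

theorem theorem1p3:
  fixes f :: "real ^ 'n \<Rightarrow> real ^ 'n" and u :: "real ^ 'n"
  assumes "f \<in> pos_cone \<rightarrow> pos_cone"
    and "monotone_homogeneous f"
    and "positive_eigenvector f u"
  shows "(\<forall>v. positive_eigenvector f v \<longrightarrow> (\<exists>c>0. v = c *\<^sub>R u)) \<longleftrightarrow>
    \<not> (\<exists>D E. min_dominion f u D \<and> max_dominion f u E \<and> D \<inter> E = {})"
proof -
  let ?S = "centred_log_conj f u"
  interpret S: normalized_operator ?S
    using assms(1,2) by (rule normalized_operator_centred_log_conj)
  interpret d: normalized_operator "dual ?S" by (rule S.normalized_operator_dual)
  have u: "u \<in> pos_cone" using assms(3) by (simp add: positive_eigenvector_def)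
  have min_dom: "min_dominion f u D \<longleftrightarrow> D \<noteq> {} \<and> (\<forall>i\<in>D. D \<in> actions ?S i)" for D
    unfolding min_dominion_def min_actions_eq[abs_def] max_actions_eq[abs_def]
    by (intro is_dominion_iff S.UNIV_in_actions d.UNIV_in_actions S.actions_meet)
      (auto intro: S.actions_superset)
  have "J \<inter> I \<noteq> {}" if "J \<in> actions (dual ?S) i" "I \<in> actions ?S i" for i I J
    using S.actions_meet[OF that(2,1)] by (simp add: Int_commute)
  then have max_dom: "max_dominion f u E \<longleftrightarrow> E \<noteq> {} \<and> (\<forall>i\<in>E. E \<in> actions (dual ?S) i)" for E
    unfolding max_dominion_def min_actions_eq[abs_def] max_actions_eq[abs_def]
    by (intro is_dominion_iff S.UNIV_in_actions d.UNIV_in_actions)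
      (auto intro: d.actions_superset)
  (* Every positive vector has the form exp (log u + x). *)
  have "(\<forall>v. positive_eigenvector f v \<longrightarrow> (\<exists>c>0. v = c *\<^sub>R u)) \<longleftrightarrow>
      (\<forall>x. positive_eigenvector f (exp_vec (log_vec u + x))
        \<longrightarrow> (\<exists>c>0. exp_vec (log_vec u + x) = c *\<^sub>R u))"
  proof (intro iffI allI impI)
    fix v
    assume *: "\<forall>x. positive_eigenvector f (exp_vec (log_vec u + x))
        \<longrightarrow> (\<exists>c>0. exp_vec (log_vec u + x) = c *\<^sub>R u)" and v: "positive_eigenvector f v"
    have "exp_vec (log_vec u + (log_vec v - log_vec u)) = v"
      using v by (simp add: positive_eigenvector_def exp_vec_log_vec)
    then show "\<exists>c>0. v = c *\<^sub>R u" using * v by metis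
  qed blast
  also have "\<dots> \<longleftrightarrow> (\<forall>x. ?S x = x \<longrightarrow> (\<forall>k l. x $ k = x $ l))"
    by (simp only: positive_eigenvector_iff_fixed_point[OF assms]
        exp_vec_log_vec_add_proportional_iff[OF u])
  also have "\<dots> \<longleftrightarrow> \<not> (\<exists>D E. min_dominion f u D \<and> max_dominion f u E \<and> D \<inter> E = {})"
  proof
    assume const: "\<forall>x. ?S x = x \<longrightarrow> (\<forall>k l. x $ k = x $ l)"
    show "\<not> (\<exists>D E. min_dominion f u D \<and> max_dominion f u E \<and> D \<inter> E = {})"
    proof
      assume "\<exists>D E. min_dominion f u D \<and> max_dominion f u E \<and> D \<inter> E = {}"
      then obtain D E where "min_dominion f u D" "max_dominion f u E" and disj: "D \<inter> E = {}"
        by (elim exE conjE)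
      then have "D \<noteq> {}" "\<forall>i\<in>D. D \<in> actions ?S i"
        "E \<noteq> {}" "\<forall>i\<in>E. E \<in> actions (dual ?S) i"
        unfolding min_dom max_dom by blast+
      from S.nonconstant_fixed_point_if_disjoint_closed_sets[OF this disj]
      obtain z k l where "?S z = z" "z $ k \<noteq> z $ l" .
      with const show False by blast
    qed
  next
    assume disj: "\<not> (\<exists>D E. min_dominion f u D \<and> max_dominion f u E \<and> D \<inter> E = {})"
    show "\<forall>x. ?S x = x \<longrightarrow> (\<forall>k l. x $ k = x $ l)"
    proof (intro allI impI, rule ccontr)
      fix x k l assume "?S x = x" "x $ k \<noteq> x $ l"
      from S.disjoint_closed_sets_if_nonconstant_fixed_point[OF this]
      obtain D E where "D \<noteq> {}" "\<forall>i\<in>D. D \<in> actions ?S i"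
        "E \<noteq> {}" "\<forall>i\<in>E. E \<in> actions (dual ?S) i" "D \<inter> E = {}" .
      then have "min_dominion f u D \<and> max_dominion f u E \<and> D \<inter> E = {}"
        using min_dom max_dom by simp
      with disj show False by blast
    qed
  qed
  finally show ?thesis .
qed

end
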